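(* Let $S$ be a finite-dimensional simple Lie algebra over a field $F$ of characteristic $0$. Let $K$ be a left $S$-module isomorphic to $S$ regarded as a left $S$-module via left multiplication (the adjoint module), and write $x'\in K$ for the element corresponding to $x\in S$ under a fixed module isomorphism, so that $s\cdot t' = (st)'$ for all $s,t\in S$. Make $K$ into a Leibniz module by defining the right action of $S$ on $K$ to be $0$, and let $L$ be the split extension of $K$ by $S$; that is, $L = S\oplus K$ as a vector space, with product $$(s,k)(t,l) = (st,\, s\cdot l)\qquad (s,t\in S,\ k,l\in K).$$ Identify $S$ with $\{(s,0)\mid s\in S\}$ and $K$ with $\{(0,k)\mid k\in K\}$. Then $L$ is a left Leibniz algebra with $\operatorname{Leib}(L)=K$. The space $S_1=\{(s,s')\mid s\in S\}$ is, besides $S$, another subalgebra of $L$ complementing $K$ (that is, $S_1+K=L$ and $S_1\cap K=0$), since $(s,s')(t,t')=(st,\,s\cdot t')=(st,(st)')$. For any $x=(s,k)\in L$, the inner derivation $d_x$ equals $d_s$, so $d_x(S)\subseteq S$ and hence also $\exp(d_x)(S)\subseteq S$. Thus $S$ and $S_1$ are not conjugate.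
   Context: A left Leibniz algebra over a field $F$ is an $F$-vector space $L$ with a bilinear product $(a,b)\mapsto ab$ such that every left multiplication operator $d_a\colon L\to L$, $d_a(x)=ax$, is a derivation, i.e. $a(bc) = (ab)c + b(ac)$ for all $a,b,c\in L$. The operators $d_a$ are called inner derivations. The Leibniz kernel $\operatorname{Leib}(L)$ is the subspace of $L$ spanned by all squares $x^2=xx$, $x\in L$. The product in the Lie algebra $S$ is written by juxtaposition, $st=[s,t]$. Here $\exp(d_x)=\sum_{n\ge 0} d_x^n/n!$, for any $x\in L$ for which this exponential is defined (no further restriction is placed on $x$), and conjugacy of subalgebras refers to conjugacy under these maps $\exp(d_x)$, $x\in L$, and their compositions. *)

theory Defs
  imports "HOL-Analysis.Analysis"
begin

section \<open>Lie algebras, Leibniz algebras and their modules\<close>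

definition bilinear_map ::
  "('f::field \<Rightarrow> 'a::ab_group_add \<Rightarrow> 'a) \<Rightarrow> ('f \<Rightarrow> 'b::ab_group_add \<Rightarrow> 'b) \<Rightarrow>
   ('f \<Rightarrow> 'c::ab_group_add \<Rightarrow> 'c) \<Rightarrow> ('a \<Rightarrow> 'b \<Rightarrow> 'c) \<Rightarrow> bool" where
  "bilinear_map s1 s2 s3 m \<longleftrightarrow>
     (\<forall>x. Vector_Spaces.linear s2 s3 (m x)) \<and> (\<forall>y. Vector_Spaces.linear s1 s3 (\<lambda>x. m x y))"

locale nonassoc_algebra = vector_space sc
  for sc :: "'f::field \<Rightarrow> 'a::ab_group_add \<Rightarrow> 'a" +
  fixes mul :: "'a \<Rightarrow> 'a \<Rightarrow> 'a"
  assumes bilinear_mult: "bilinear_map sc sc sc mul"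
begin

definition subalgebra :: "'a set \<Rightarrow> bool" where
  "subalgebra A \<longleftrightarrow> subspace A \<and> (\<forall>x\<in>A. \<forall>y\<in>A. mul x y \<in> A)"

definition ideal :: "'a set \<Rightarrow> bool" where
  "ideal I \<longleftrightarrow> subspace I \<and> (\<forall>x. \<forall>y\<in>I. mul x y \<in> I \<and> mul y x \<in> I)"

definition derivation :: "('a \<Rightarrow> 'a) \<Rightarrow> bool" where
  "derivation D \<longleftrightarrow> Vector_Spaces.linear sc sc D \<and>
     (\<forall>x y. D (mul x y) = mul (D x) y + mul x (D y))"

end

locale lie_algebra = nonassoc_algebra sc bracket
  for sc :: "'f::field \<Rightarrow> 'a::ab_group_add \<Rightarrow> 'a" and bracket :: "'a \<Rightarrow> 'a \<Rightarrow> 'a" +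
  assumes alternating: "bracket x x = 0"
    and jacobi: "bracket x (bracket y z) + bracket y (bracket z x) + bracket z (bracket x y) = 0"

locale simple_lie_algebra = lie_algebra sc bracket
  for sc :: "'f::field \<Rightarrow> 'a::ab_group_add \<Rightarrow> 'a" and bracket :: "'a \<Rightarrow> 'a \<Rightarrow> 'a" +
  assumes nonabelian: "\<exists>x y. bracket x y \<noteq> 0"
    and ideals_trivial: "ideal I \<Longrightarrow> I = {0} \<or> I = UNIV"

text \<open>The left multiplication operator by \<open>x\<close> is the partial application \<open>mul x\<close>.\<close>

locale left_leibniz_algebra = nonassoc_algebra sc mul
  for sc :: "'f::field \<Rightarrow> 'a::ab_group_add \<Rightarrow> 'a" and mul :: "'a \<Rightarrow> 'a \<Rightarrow> 'a" +
  assumes left_mult_derivation: "derivation (mul x)"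

definition leibniz_kernel ::
  "('f::field \<Rightarrow> 'a::ab_group_add \<Rightarrow> 'a) \<Rightarrow> ('a \<Rightarrow> 'a \<Rightarrow> 'a) \<Rightarrow> 'a set" where
  "leibniz_kernel sc mul = module.span sc {mul x x | x. True}"

locale lie_module = A: lie_algebra sA bracket + M: vector_space sM
  for sA :: "'f::field \<Rightarrow> 'a::ab_group_add \<Rightarrow> 'a" and bracket :: "'a \<Rightarrow> 'a \<Rightarrow> 'a"
    and sM :: "'f \<Rightarrow> 'm::ab_group_add \<Rightarrow> 'm" +
  fixes act :: "'a \<Rightarrow> 'm \<Rightarrow> 'm"
  assumes bilinear_act: "bilinear_map sA sM sM act"
    and act_bracket: "act (bracket x y) m = act x (act y m) - act y (act x m)"

text \<open>An isomorphism from the adjoint module of a Lie algebra onto the module given by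
  \<open>sM\<close> and \<open>act\<close>.\<close>

definition adjoint_module_iso ::
  "('f::field \<Rightarrow> 'a::ab_group_add \<Rightarrow> 'a) \<Rightarrow> ('a \<Rightarrow> 'a \<Rightarrow> 'a) \<Rightarrow>
   ('f \<Rightarrow> 'm::ab_group_add \<Rightarrow> 'm) \<Rightarrow> ('a \<Rightarrow> 'm \<Rightarrow> 'm) \<Rightarrow> ('a \<Rightarrow> 'm) \<Rightarrow> bool" where
  "adjoint_module_iso sA bracket sM act \<theta> \<longleftrightarrow>
     Vector_Spaces.linear sA sM \<theta> \<and> bij \<theta> \<and> (\<forall>s t. act s (\<theta> t) = \<theta> (bracket s t))"

text \<open>The three axioms are the left Leibniz identity with exactly one of the three arguments
  taken in the module.\<close>

locale leibniz_module = A: left_leibniz_algebra sA mul + M: vector_space sM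
  for sA :: "'f::field \<Rightarrow> 'a::ab_group_add \<Rightarrow> 'a" and mul :: "'a \<Rightarrow> 'a \<Rightarrow> 'a"
    and sM :: "'f \<Rightarrow> 'm::ab_group_add \<Rightarrow> 'm" +
  fixes lact :: "'a \<Rightarrow> 'm \<Rightarrow> 'm" and ract :: "'m \<Rightarrow> 'a \<Rightarrow> 'm"
  assumes bilinear_lact: "bilinear_map sA sM sM lact"
    and bilinear_ract: "bilinear_map sM sA sM ract"
    and lact_lact: "lact x (lact y m) = lact (mul x y) m + lact y (lact x m)"
    and lact_ract: "lact x (ract m y) = ract (lact x m) y + ract m (mul x y)"
    and ract_mult: "ract m (mul x y) = ract (ract m x) y + lact x (ract m y)"

definition split_ext_mult ::
  "('a \<Rightarrow> 'a \<Rightarrow> 'a) \<Rightarrow> ('a \<Rightarrow> 'm \<Rightarrow> 'm) \<Rightarrow> ('m \<Rightarrow> 'a \<Rightarrow> 'm::ab_group_add) \<Rightarrow>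
   'a \<times> 'm \<Rightarrow> 'a \<times> 'm \<Rightarrow> 'a \<times> 'm" where
  "split_ext_mult mul lact ract p q =
     (mul (fst p) (fst q), lact (fst p) (snd q) + ract (snd p) (fst q))"

definition complementary :: "'a::ab_group_add set \<Rightarrow> 'a set \<Rightarrow> bool" where
  "complementary A B \<longleftrightarrow> {a + b | a b. a \<in> A \<and> b \<in> B} = UNIV \<and> A \<inter> B = {0}"


section \<open>Exponentials over an arbitrary field\<close>

text \<open>An exponential series over a field makes sense relative to a notion of convergence, that is,
  to a Hausdorff field topology. The discrete topology accounts for the purely algebraic
  exponentials of nilpotent operators, and the usual topologies of the reals, the complex numbers
  and the p-adic fields account for convergent series.\<close>

definition topological_field :: "'f::field topology \<Rightarrow> bool" where
  "topological_field T \<longleftrightarrow> topspace T = UNIV \<and> Hausdorff_space T \<and>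
     continuous_map (prod_topology T T) T (\<lambda>(x, y). x + y) \<and>
     continuous_map T T (\<lambda>x. - x) \<and>
     continuous_map (prod_topology T T) T (\<lambda>(x, y). x * y) \<and>
     continuous_map (subtopology T (- {0})) T inverse"

text \<open>In a finite-dimensional space the following is coordinatewise convergence with respect to
  one, equivalently every, basis.\<close>

definition vec_limit ::
  "('f::field \<Rightarrow> 'a::ab_group_add \<Rightarrow> 'a) \<Rightarrow> 'f topology \<Rightarrow> (nat \<Rightarrow> 'a) \<Rightarrow> 'a \<Rightarrow> bool" where
  "vec_limit sc T u l \<longleftrightarrow>
     (\<forall>\<phi>. Vector_Spaces.linear sc (*) \<phi> \<longrightarrow> limitin T (\<lambda>n. \<phi> (u n)) (\<phi> l) sequentially)"

text \<open>\<open>has_exp sc T D E\<close>: the exponential of the operator \<open>D\<close> is defined and equals \<open>E\<close>.\<close>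

definition has_exp ::
  "('f::field_char_0 \<Rightarrow> 'a::ab_group_add \<Rightarrow> 'a) \<Rightarrow> 'f topology \<Rightarrow> ('a \<Rightarrow> 'a) \<Rightarrow> ('a \<Rightarrow> 'a) \<Rightarrow> bool" where
  "has_exp sc T D E \<longleftrightarrow>
     (\<forall>v. vec_limit sc T (\<lambda>N. \<Sum>n<N. sc (inverse (fact n)) ((D ^^ n) v)) (E v))"

inductive_set inner_exp_maps ::
  "('f::field_char_0 \<Rightarrow> 'a::ab_group_add \<Rightarrow> 'a) \<Rightarrow> ('a \<Rightarrow> 'a \<Rightarrow> 'a) \<Rightarrow> 'f topology \<Rightarrow> ('a \<Rightarrow> 'a) set"
  for sc mul T where
  exp_left_mult: "has_exp sc T (mul x) E \<Longrightarrow> E \<in> inner_exp_maps sc mul T"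
| comp: "g \<in> inner_exp_maps sc mul T \<Longrightarrow> h \<in> inner_exp_maps sc mul T \<Longrightarrow>
    g \<circ> h \<in> inner_exp_maps sc mul T"

definition conjugate_onto ::
  "('f::field_char_0 \<Rightarrow> 'a::ab_group_add \<Rightarrow> 'a) \<Rightarrow> ('a \<Rightarrow> 'a \<Rightarrow> 'a) \<Rightarrow> 'f topology \<Rightarrow>
   'a set \<Rightarrow> 'a set \<Rightarrow> bool" where
  "conjugate_onto sc mul T A B \<longleftrightarrow> (\<exists>g\<in>inner_exp_maps sc mul T. g ` A = B)"

lemma topological_field_discrete: "topological_field (discrete_topology UNIV)"
  by (simp add: topological_field_def Hausdorff_space_discrete_topology
      flip: prod_topology_discrete_topology)

lemma has_exp_nilpotent:
  assumes "vector_space sc" "topological_field T"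
    and nil: "\<And>n v. m \<le> n \<Longrightarrow> (D ^^ n) v = 0"
  shows "has_exp sc T D (\<lambda>v. \<Sum>n<m. sc (inverse (fact n)) ((D ^^ n) v))"
proof -
  interpret vector_space sc by fact
  have eq: "(\<Sum>n<N. sc (inverse (fact n)) ((D ^^ n) v)) =
      (\<Sum>n<m. sc (inverse (fact n)) ((D ^^ n) v))" if "m \<le> N" for N v
    by (rule sum.mono_neutral_right) (use that nil in auto)
  show ?thesis
    unfolding has_exp_def vec_limit_def
  proof (intro allI impI limitin_eventually)
    fix v \<phi>
    show "\<forall>\<^sub>F N in sequentially. \<phi> (\<Sum>n<N. sc (inverse (fact n)) ((D ^^ n) v)) =
        \<phi> (\<Sum>n<m. sc (inverse (fact n)) ((D ^^ n) v))"
      unfolding eventually_sequentially using eq by metis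
  qed (use assms(2) in \<open>auto simp: topological_field_def\<close>)
qed

lemma has_exp_unique:
  assumes "vector_space sc" "topological_field T"
    and E: "has_exp sc T D E" and E': "has_exp sc T D E'"
  shows "E = E'"
proof (rule ccontr)
  assume "E \<noteq> E'"
  then obtain v where v: "E v - E' v \<noteq> 0" by auto
  interpret vector_space sc by fact
  interpret P: vector_space_pair sc "(*)"
    by unfold_locales (auto simp: algebra_simps)
  have "independent {E v - E' v}" using v by simp
  then obtain \<phi> where \<phi>: "Vector_Spaces.linear sc (*) \<phi>" "\<phi> (E v - E' v) = 1"
    using P.linear_independent_extend[of "{E v - E' v}" "\<lambda>_. 1"] by auto
  have "\<phi> (E v) = \<phi> (E' v)"
    using E E' \<phi>(1) assms(2)
    unfolding has_exp_def vec_limit_def topological_field_def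
    by (meson limitin_Hausdorff_unique trivial_limit_sequentially)
  with \<phi> show False by (simp add: P.linear_diff)
qed

end

(*
  The operator d_x of x = (s, k) is (t, l) |-> (st, s.l), so it leaves both S and S_1 invariant.
  A linear functional that vanishes on an invariant subspace vanishes on the partial sums of the
  exponential series, hence on their limit; as functionals separate points from subspaces, every
  exp(d_x) leaves S and S_1 invariant as well. Therefore no composite of such exponentials maps
  one of them onto the other, since neither contains the other.
*)
theory Submission
  imports Defs
begin

section \<open>Separation by linear functionals and invariant subspaces of exponentials\<close>

lemma bilinear_map_iff:
  "bilinear_map s1 s2 s3 m \<longleftrightarrow> vector_space s1 \<and> vector_space s2 \<and> vector_space s3 \<and>
     (\<forall>x y z. m (x + y) z = m x z + m y z) \<and> (\<forall>x y z. m x (y + z) = m x y + m x z) \<and>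
     (\<forall>c x y. m (s1 c x) y = s3 c (m x y)) \<and> (\<forall>c x y. m x (s2 c y) = s3 c (m x y))"
  unfolding bilinear_map_def Vector_Spaces.linear_iff by auto

text \<open>A basis \<open>B\<close> of \<open>W\<close> stays independent when \<open>v\<close> is
  added, so prescribing 0 on \<open>B\<close> and 1 at \<open>v\<close> extends to a linear
  functional on the whole space. Finite dimension does not enter.\<close>

lemma (in vector_space) separating_functional:
  assumes "subspace W" "v \<notin> W"
  shows "\<exists>\<phi>. Vector_Spaces.linear scale (*) \<phi> \<and> (\<forall>w\<in>W. \<phi> w = 0) \<and> \<phi> v = 1"
proof -
  interpret P: vector_space_pair scale "(*)"
    by unfold_locales (auto simp: algebra_simps)
  obtain B where B: "B \<subseteq> W" "independent B" "W \<subseteq> span B"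
    by (rule maximal_independent_subset)
  have v: "v \<notin> span B"
    using assms B(1) span_minimal by blast
  then have "independent (insert v B)"
    using B(2) by (rule independent_insertI)
  from P.linear_independent_extend[OF this, of "\<lambda>x. if x = v then 1 else 0"]
  obtain \<phi> where \<phi>: "Vector_Spaces.linear scale (*) \<phi>"
      and eq: "\<forall>x\<in>insert v B. \<phi> x = (if x = v then 1 else 0)"
    by blast
  have "v \<notin> B"
    using v span_base by blast
  with eq have "\<phi> b = 0" if "b \<in> B" for b
    using that by auto
  then have "\<phi> w = 0" if "w \<in> W" for w
    using P.linear_eq_0_on_span[OF \<phi>] that B(3) by blast
  moreover have "\<phi> v = 1"
    using eq by simp
  ultimately show ?thesis
    using \<phi> by blast
qed

lemma has_exp_invariant_subspace:
  assumes "vector_space sc" "topological_field T"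
    and W: "module.subspace sc W" "D ` W \<subseteq> W"
    and E: "has_exp sc T D E"
  shows "E ` W \<subseteq> W"
proof
  fix y assume "y \<in> E ` W"
  then obtain v where v: "v \<in> W" "y = E v" by auto
  interpret vector_space sc by fact
  show "y \<in> W"
  proof (rule ccontr)
    assume "y \<notin> W"
    \<comment> \<open>\<open>vec_limit\<close> tests convergence on every linear functional, so the
      separating \<open>\<phi>\<close> can be applied to the exponential series directly, without
      coordinates.\<close>
    obtain \<phi> where \<phi>: "Vector_Spaces.linear sc (*) \<phi>"
        "\<forall>w\<in>W. \<phi> w = 0" "\<phi> y = 1"
      using separating_functional[OF W(1) \<open>y \<notin> W\<close>] by blast
    have "(D ^^ n) v \<in> W" for n
      by (induction n) (use v W in auto)
    then have "\<phi> (\<Sum>n<N. sc (inverse (fact n)) ((D ^^ n) v)) = 0" for N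
      by (intro bspec[OF \<phi>(2)] subspace_sum subspace_scale W(1))
    moreover have "limitin T (\<lambda>N. \<phi> (\<Sum>n<N. sc (inverse (fact n)) ((D ^^ n) v))) (\<phi> y) sequentially"
      using E \<phi>(1) v(2) unfolding has_exp_def vec_limit_def by blast
    \<comment> \<open>The constant sequence 0 now has both \<open>\<phi> y\<close> and 0 as limits,
      and limits in the Hausdorff topology \<open>T\<close> are unique.\<close>
    ultimately have "limitin T (\<lambda>n. 0) (\<phi> y) sequentially"
      by simp
    moreover have "limitin T (\<lambda>n. 0) 0 sequentially"
      using assms(2) by (simp add: topological_field_def)
    ultimately have "\<phi> y = 0"
      using assms(2) unfolding topological_field_def
      by (meson limitin_Hausdorff_unique trivial_limit_sequentially)
    with \<phi>(3) show False by simp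
  qed
qed

lemma inner_exp_maps_invariant_subspace:
  assumes "vector_space sc" "topological_field T"
    and W: "module.subspace sc W" "\<And>x. mul x ` W \<subseteq> W"
    and "g \<in> inner_exp_maps sc mul T"
  shows "g ` W \<subseteq> W"
  using assms(5)
proof induction
  case (exp_left_mult x E)
  then show ?case using has_exp_invariant_subspace assms by metis
next
  case (comp g h)
  then show ?case by (auto simp: image_subset_iff)
qed

section \<open>Lie algebras as left Leibniz algebras\<close>

context lie_algebra
begin

lemma bracket_add_left: "bracket (x + y) z = bracket x z + bracket y z"
  and bracket_add_right: "bracket x (y + z) = bracket x y + bracket x z"
  using bilinear_mult by (simp_all add: bilinear_map_iff)

lemma bracket_zero_right: "bracket x 0 = 0"
  using bracket_add_right[of x 0 0] by simp

lemma bracket_minus_right: "bracket x (- y) = - bracket x y"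
  using bracket_add_right[of x "- y" y] by (simp add: bracket_zero_right eq_neg_iff_add_eq_0)

lemma bracket_anticommute: "bracket y x = - bracket x y"
proof -
  have "bracket (x + y) (x + y) = bracket x x + bracket x y + (bracket y x + bracket y y)"
    by (simp only: bracket_add_left bracket_add_right ac_simps)
  then show ?thesis
    by (simp add: alternating eq_neg_iff_add_eq_0 add.commute)
qed

text \<open>This is the Jacobi identity with \<open>bracket z x\<close> and
  \<open>bracket z (bracket x y)\<close> turned around by anticommutativity.\<close>

lemma bracket_leibniz: "bracket x (bracket y z) = bracket (bracket x y) z + bracket y (bracket x z)"
  using jacobi[of x y z] bracket_anticommute[of z x] bracket_anticommute[of z "bracket x y"]
  by (simp add: bracket_minus_right algebra_simps)

lemma left_leibniz_algebra: "left_leibniz_algebra sc bracket"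
proof
  show "derivation (bracket x)" for x
    unfolding derivation_def
  proof (intro conjI allI)
    show "Vector_Spaces.linear sc sc (bracket x)"
      using bilinear_mult by (simp add: bilinear_map_def)
  qed (rule bracket_leibniz)
qed

end

text \<open>A subspace containing all brackets is automatically an ideal; simplicity leaves only
  zero, excluded by \<open>nonabelian\<close>, or everything. This perfectness is what makes the
  Leibniz kernel fill all of \<open>K\<close>.\<close>

lemma (in simple_lie_algebra) span_brackets: "span {bracket x y | x y. True} = UNIV"
proof -
  let ?I = "span {bracket x y | x y. True}"
  have br: "bracket x y \<in> ?I" for x y
    by (rule span_base) blast
  then have "ideal ?I"
    by (simp add: ideal_def)
  with ideals_trivial have "?I = {0} \<or> ?I = UNIV" .
  with nonabelian br show ?thesis by (metis singletonD)
qed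

lemma (in simple_lie_algebra) ex_nonzero: "\<exists>x::'a. x \<noteq> 0"
  using nonabelian by blast

section \<open>Leibniz modules and split extensions\<close>

context lie_module
begin

lemma act_zero: "act x 0 = 0"
  using bilinear_act unfolding bilinear_map_iff by (metis add_cancel_right_right)

text \<open>With zero right action, \<open>lact_lact\<close> is \<open>act_bracket\<close>
  rearranged, and the two axioms involving \<open>ract\<close> reduce to 0 = 0 by
  \<open>act_zero\<close>.\<close>

lemma leibniz_module_zero_right: "leibniz_module sA bracket sM act (\<lambda>m x. 0)"
proof -
  interpret L: left_leibniz_algebra sA bracket by (rule A.left_leibniz_algebra)
  show ?thesis
    by unfold_locales
      (use bilinear_act in \<open>auto simp: act_bracket act_zero bilinear_map_iff\<close>)
qed

end

context leibniz_module
begin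

interpretation P: vector_space_prod sA sM ..

text \<open>The first component of the Leibniz identity is the identity of the acting algebra. The
  second is a sum of three parts, according to which of the three factors contributes its module
  component, and each part is one of the module axioms; two module components never meet in a
  product.\<close>

lemma left_leibniz_algebra_split_ext:
  "left_leibniz_algebra (module_prod.scale sA sM) (split_ext_mult mul lact ract)"
proof -
  have bl: "bilinear_map sA sA sA mul" "bilinear_map sA sM sM lact" "bilinear_map sM sA sM ract"
    by (rule A.bilinear_mult bilinear_lact bilinear_ract)+
  note bl = bl[unfolded bilinear_map_iff]
  have bm: "bilinear_map P.scale P.scale P.scale (split_ext_mult mul lact ract)"
    unfolding bilinear_map_iff
    by (simp add: bl P.p.vector_space_axioms split_ext_mult_def P.scale_def
        M.scale_right_distrib ac_simps)
  then interpret N: nonassoc_algebra P.scale "split_ext_mult mul lact ract"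
    by unfold_locales
  have leib: "mul x (mul y z) = mul (mul x y) z + mul y (mul x z)" for x y z
    using A.left_mult_derivation unfolding A.derivation_def by blast
  show ?thesis
  proof
    fix p
    show "N.derivation (split_ext_mult mul lact ract p)"
      unfolding N.derivation_def
    proof (intro conjI allI)
      show "Vector_Spaces.linear P.scale P.scale (split_ext_mult mul lact ract p)"
        using bm unfolding bilinear_map_def by blast
      show "split_ext_mult mul lact ract p (split_ext_mult mul lact ract q r) =
          split_ext_mult mul lact ract (split_ext_mult mul lact ract p q) r +
          split_ext_mult mul lact ract q (split_ext_mult mul lact ract p r)" for q r
        using leib[of "fst p" "fst q" "fst r"] lact_lact[of "fst p" "fst q" "snd r"]
          lact_ract[of "fst p" "snd q" "fst r"] ract_mult[of "snd p" "fst q" "fst r"]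
        by (simp add: split_ext_mult_def bl ac_simps)
    qed
  qed
qed

end

section \<open>The split extension of a simple Lie algebra by its adjoint module\<close>

theorem mainTheorem2:
  fixes scS :: "'f::field_char_0 \<Rightarrow> 's::ab_group_add \<Rightarrow> 's"
    and br :: "'s \<Rightarrow> 's \<Rightarrow> 's"
    and scK :: "'f \<Rightarrow> 'k::ab_group_add \<Rightarrow> 'k"
    and act :: "'s \<Rightarrow> 'k \<Rightarrow> 'k"
    and \<theta> :: "'s \<Rightarrow> 'k"
    and T :: "'f topology"
    and basis :: "'s set"
    and scL :: "'f \<Rightarrow> 's \<times> 'k \<Rightarrow> 's \<times> 'k"
    and ml :: "'s \<times> 'k \<Rightarrow> 's \<times> 'k \<Rightarrow> 's \<times> 'k"
    and S K S\<^sub>1 :: "('s \<times> 'k) set"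
  assumes findim: "finite_dimensional_vector_space scS basis"
    and simple: "simple_lie_algebra scS br"
    and K_module: "lie_module scS br scK act"
    and iso: "adjoint_module_iso scS br scK act \<theta>"
    and T_field: "topological_field T"
    and scL_def: "scL = module_prod.scale scS scK"
    and ml_def: "ml = split_ext_mult br act (\<lambda>k s. 0)"
    and S_def: "S = {(s, 0) | s. True}"
    and K_def: "K = {(0, k) | k. True}"
    and S\<^sub>1_def: "S\<^sub>1 = {(s, \<theta> s) | s. True}"
  shows "leibniz_module scS br scK act (\<lambda>k s. 0)
    \<and> (\<forall>s k t l. ml (s, k) (t, l) = (br s t, act s l))
    \<and> left_leibniz_algebra scL ml
    \<and> leibniz_kernel scL ml = K
    \<and> nonassoc_algebra.subalgebra scL ml S \<and> complementary S K
    \<and> nonassoc_algebra.subalgebra scL ml S\<^sub>1 \<and> complementary S\<^sub>1 K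
    \<and> S\<^sub>1 \<noteq> S
    \<and> (\<forall>s t. ml (s, \<theta> s) (t, \<theta> t) = (br s t, act s (\<theta> t))
             \<and> (br s t, act s (\<theta> t)) = (br s t, \<theta> (br s t)))
    \<and> (\<forall>s k. ml (s, k) = ml (s, 0))
    \<and> (\<forall>x. ml x ` S \<subseteq> S)
    \<and> (\<forall>x E. has_exp scL T (ml x) E \<longrightarrow> E ` S \<subseteq> S)
    \<and> \<not> conjugate_onto scL ml T S S\<^sub>1
    \<and> \<not> conjugate_onto scL ml T S\<^sub>1 S"
proof -
  interpret A: simple_lie_algebra scS br by fact
  interpret M: lie_module scS br scK act by fact
  interpret LM: leibniz_module scS br scK act "\<lambda>k s. 0"
    by (rule M.leibniz_module_zero_right)
  interpret P: vector_space_prod scS scK ..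
  have scL: "scL c (s, k) = (scS c s, scK c k)" for c s k
    by (simp add: scL_def P.scale_def)
  have ml: "ml (s, k) (t, l) = (br s t, act s l)" for s k t l
    by (simp add: ml_def split_ext_mult_def)
  interpret L: left_leibniz_algebra scL ml
    unfolding scL_def ml_def by (rule LM.left_leibniz_algebra_split_ext)
  interpret \<theta>: Vector_Spaces.linear scS scK \<theta>
    using iso by (simp add: adjoint_module_iso_def)
  have bij: "bij \<theta>" and act_\<theta>: "act s (\<theta> t) = \<theta> (br s t)" for s t
    using iso by (auto simp: adjoint_module_iso_def)
  have \<theta>_0_iff: "\<theta> s = 0 \<longleftrightarrow> s = 0" for s
    using bij \<theta>.zero by (metis bij_pointE)
  obtain s0 :: 's where s0: "s0 \<noteq> 0" using A.ex_nonzero by blast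

  have subS: "L.subspace S" and subS1: "L.subspace S\<^sub>1" and subK: "L.subspace K"
    by (auto simp: L.subspace_def S_def S\<^sub>1_def K_def scL zero_prod_def \<theta>.add \<theta>.scale \<theta>.zero)
  \<comment> \<open>For x = (s, k), the image of (t, 0) has second component \<open>act s 0\<close>,
    which is 0, while (t, \<theta> t) goes to (st, \<theta>(st)) because \<theta> intertwines the
    bracket with the action.\<close>
  have invS: "ml x ` S \<subseteq> S" and invS1: "ml x ` S\<^sub>1 \<subseteq> S\<^sub>1" for x
    by (cases x; auto simp: S_def S\<^sub>1_def ml M.act_zero act_\<theta>)+
  have "leibniz_kernel scL ml = K"
    unfolding leibniz_kernel_def
  proof
    show "L.span {ml x x | x. True} \<subseteq> K"
      \<comment> \<open>The square of (s, k) is (ss, s.k), and ss = 0 puts it in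
        \<open>K\<close>.\<close>
      by (rule L.span_minimal[OF _ subK]) (auto simp: K_def ml A.alternating)
    \<comment> \<open>The span of the squares is pulled back along v |-> (0, \<theta> v) to a
      subspace of the Lie algebra, where perfectness can be used.\<close>
    have "{v. (0, \<theta> v) \<in> L.span {ml x x | x. True}} = UNIV" (is "?V = _")
    proof -
      have "A.subspace ?V"
      proof (rule A.subspaceI)
        show "0 \<in> ?V"
          using L.span_zero by (simp add: \<theta>.zero zero_prod_def)
        show "x + y \<in> ?V" if "x \<in> ?V" "y \<in> ?V" for x y
          using L.span_add that by (fastforce simp: \<theta>.add)
        show "scS c x \<in> ?V" if "x \<in> ?V" for c x
          using L.span_scale[of "(0, \<theta> x)" _ c] that by (simp add: \<theta>.scale scL)
      qed
      moreover have "br s t \<in> ?V" for s t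
      proof -
        \<comment> \<open>Pairing s with the module copy of t gives an element whose square isolates
          the bracket st in the module component.\<close>
        have "ml (s, \<theta> t) (s, \<theta> t) = (0, \<theta> (br s t))"
          by (simp add: ml A.alternating act_\<theta>)
        then show ?thesis
          by (metis (mono_tags, lifting) L.span_base mem_Collect_eq)
      qed
      ultimately have "A.span {br s t | s t. True} \<subseteq> ?V"
        by (intro A.span_minimal) auto
      then show ?thesis
        using A.span_brackets by blast
    qed
    then have "(0, \<theta> v) \<in> L.span {ml x x | x. True}" for v
      by blast
    then have "(0, k) \<in> L.span {ml x x | x. True}" for k
      using surjD[OF bij_is_surj[OF bij], of k] by auto
    then show "K \<subseteq> L.span {ml x x | x. True}"
      by (auto simp: K_def)
  qed
  have "complementary S K"
  proof -
    have "(s, k) = (s, 0) + (0, k)" for s :: 's and k :: 'k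
      by simp
    then have "p \<in> {a + b | a b. a \<in> S \<and> b \<in> K}" for p
      unfolding S_def K_def by (cases p) blast
    moreover have "S \<inter> K = {0}"
      by (auto simp: S_def K_def zero_prod_def)
    ultimately show ?thesis
      unfolding complementary_def by blast
  qed
  have "complementary S\<^sub>1 K"
  proof -
    have "(s, k) = (s, \<theta> s) + (0, k - \<theta> s)" for s k
      by simp
    then have "p \<in> {a + b | a b. a \<in> S\<^sub>1 \<and> b \<in> K}" for p
      unfolding S\<^sub>1_def K_def by (cases p) blast
    moreover have "S\<^sub>1 \<inter> K = {0}"
      by (auto simp: S\<^sub>1_def K_def zero_prod_def \<theta>.zero)
    ultimately show ?thesis
      unfolding complementary_def by blast
  qed
  have "L.subalgebra S" "L.subalgebra S\<^sub>1"
    using subS subS1 invS invS1 unfolding L.subalgebra_def by blast+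
  \<comment> \<open>The witnesses are (s0, 0) and (s0, \<theta> s0): as \<theta> is injective,
    \<theta> s0 is not 0.\<close>
  have nS: "\<not> S \<subseteq> S\<^sub>1" "\<not> S\<^sub>1 \<subseteq> S"
    using s0 \<theta>_0_iff by (auto simp: S_def S\<^sub>1_def)
  have "\<not> conjugate_onto scL ml T S S\<^sub>1" "\<not> conjugate_onto scL ml T S\<^sub>1 S"
    using inner_exp_maps_invariant_subspace[where mul = ml,
        OF L.vector_space_axioms T_field subS invS]
      inner_exp_maps_invariant_subspace[where mul = ml,
        OF L.vector_space_axioms T_field subS1 invS1] nS
    unfolding conjugate_onto_def by blast+
  have "E ` S \<subseteq> S" if "has_exp scL T (ml x) E" for x E
    using has_exp_invariant_subspace[OF L.vector_space_axioms T_field subS invS that] .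
  have "ml (s, k) = ml (s, 0)" for s k
    by (rule ext) (simp add: ml split_paired_all)
  have "S\<^sub>1 \<noteq> S"
    using nS by blast
  show ?thesis
    by (intro conjI allI impI)
      (fact LM.leibniz_module_axioms L.left_leibniz_algebra_axioms | fact | simp only: ml act_\<theta>)+
qed

end
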